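(* Let $(\widetilde{M},\tilde g)$ be a Riemannian manifold endowed with an anti-torqued vector field $V$, and let $M$ be a hypersurface of $\widetilde{M}$ such that the tangential component of $V$ along $M$ vanishes identically. Then $M$ is totally umbilical in $\widetilde{M}$. (That is, the totally umbilical hypersurfaces are the only hypersurfaces of $\widetilde{M}$ on which the tangential component of $V$ vanishes identically.)
   Context: $\widetilde{\nabla}$ is the Levi-Civita connection of $\widetilde{M}$. A non-vanishing vector field $V$ is anti-torqued if there is a smooth function $f$ with $\widetilde{\nabla}_X V=f\,(X-\tilde g(X,V)V)$ for all vector fields $X$ on $\widetilde{M}$. A submanifold is totally umbilical if for every normal vector $\xi$ the shape operator satisfies $A_\xi=\mu\,\mathrm{Id}$ for some function $\mu$. *)

theory Defs
  imports "HOL-Analysis.Analysis"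
begin

text \<open>Local-coordinate model of Riemannian geometry. A Riemannian manifold is
modelled by an open coordinate domain U in R^n (type real^'n) together with a
smooth field G of symmetric positive definite matrices (the metric tensor
g_ij). Hypersurfaces are modelled by local parametrizations (immersions)
phi : W \<subseteq> R^m \<rightarrow> U with n = m + 1.\<close>

text \<open>Directional (Frechet) derivative of f at x in direction v.\<close>
definition D :: "('a::real_normed_vector \<Rightarrow> 'b::real_normed_vector) \<Rightarrow> 'a \<Rightarrow> 'a \<Rightarrow> 'b" where
  "D f x v = frechet_derivative f (at x) v"

text \<open>C^k on an open set: continuous, and (for k+1) differentiable with all
directional derivatives C^k. Smooth = C^k for all k.\<close>
fun Ck_on :: "nat \<Rightarrow> ('a::euclidean_space \<Rightarrow> 'b::euclidean_space) \<Rightarrow> 'a set \<Rightarrow> bool" where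
  "Ck_on 0 f S = continuous_on S f"
| "Ck_on (Suc k) f S = (f differentiable_on S \<and> (\<forall>v. Ck_on k (\<lambda>x. D f x v) S))"

definition smooth_on :: "('a::euclidean_space \<Rightarrow> 'b::euclidean_space) \<Rightarrow> 'a set \<Rightarrow> bool" where
  "smooth_on f S = (\<forall>k. Ck_on k f S)"

text \<open>Riemannian metric given by the matrix field G.\<close>
definition riem_metric :: "(real^'n \<Rightarrow> real^'n^'n) \<Rightarrow> (real^'n) set \<Rightarrow> bool" where
  "riem_metric G U \<longleftrightarrow> open U \<and> smooth_on G U \<and>
     (\<forall>p\<in>U. transpose (G p) = G p \<and> (\<forall>x. x \<noteq> 0 \<longrightarrow> x \<bullet> (G p *v x) > 0))"

definition gmet :: "(real^'n \<Rightarrow> real^'n^'n) \<Rightarrow> real^'n \<Rightarrow> real^'n \<Rightarrow> real^'n \<Rightarrow> real" where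
  "gmet G p x y = x \<bullet> (G p *v y)"

text \<open>Christoffel symbols of the Levi-Civita connection, as the bilinear map
Gamma_p(x,y) characterised by
g(Gamma(x,y), z) = 1/2 (d_x g(y,z) + d_y g(x,z) - d_z g(x,y)).\<close>
definition christoffel :: "(real^'n \<Rightarrow> real^'n^'n) \<Rightarrow> real^'n \<Rightarrow> real^'n \<Rightarrow> real^'n \<Rightarrow> real^'n" where
  "christoffel G p x y = (1/2) *\<^sub>R (matrix_inv (G p) *v
     (\<chi> l. y \<bullet> (D G p x *v axis l 1) + x \<bullet> (D G p y *v axis l 1)
           - x \<bullet> (D G p (axis l 1) *v y)))"

text \<open>Levi-Civita covariant derivative of the vector field V in direction X at p.\<close>
definition levi_civita :: "(real^'n \<Rightarrow> real^'n^'n) \<Rightarrow> real^'n \<Rightarrow> real^'n \<Rightarrow> (real^'n \<Rightarrow> real^'n) \<Rightarrow> real^'n" where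
  "levi_civita G p X V = D V p X + christoffel G p X (V p)"

text \<open>Anti-torqued vector field: non-vanishing, and there is a smooth f with
nabla_X V = f (X - g(X,V) V) for all X.\<close>
definition anti_torqued :: "(real^'n \<Rightarrow> real^'n^'n) \<Rightarrow> (real^'n) set \<Rightarrow> (real^'n \<Rightarrow> real^'n) \<Rightarrow> bool" where
  "anti_torqued G U V \<longleftrightarrow> smooth_on V U \<and> (\<forall>p\<in>U. V p \<noteq> 0) \<and>
     (\<exists>f::real^'n \<Rightarrow> real. smooth_on f U \<and>
        (\<forall>p\<in>U. \<forall>X. levi_civita G p X V = f p *\<^sub>R (X - gmet G p X (V p) *\<^sub>R V p)))"

text \<open>Local parametrized hypersurface phi : W \<rightarrow> U (injective smooth immersion,
W open in R^m, n = m + 1).\<close>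
definition hypersurface_param :: "(real^'n) set \<Rightarrow> (real^'m) set \<Rightarrow> (real^'m \<Rightarrow> real^'n) \<Rightarrow> bool" where
  "hypersurface_param U W phi \<longleftrightarrow> CARD('n) = CARD('m) + 1 \<and> open W \<and>
     smooth_on phi W \<and> phi ` W \<subseteq> U \<and> inj_on phi W \<and> (\<forall>w\<in>W. inj (D phi w))"

text \<open>Normal vectors to the hypersurface at the point phi w.\<close>
definition normal_vec :: "(real^'n \<Rightarrow> real^'n^'n) \<Rightarrow> (real^'m \<Rightarrow> real^'n) \<Rightarrow> real^'m \<Rightarrow> real^'n \<Rightarrow> bool" where
  "normal_vec G phi w \<xi> \<longleftrightarrow> (\<forall>u. gmet G (phi w) \<xi> (D phi w u) = 0)"

text \<open>Ambient covariant derivative of the tangent field d phi(v) along d phi(u):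
its normal component is the second fundamental form h(u,v).\<close>
definition amb_hess :: "(real^'n \<Rightarrow> real^'n^'n) \<Rightarrow> (real^'m \<Rightarrow> real^'n) \<Rightarrow> real^'m \<Rightarrow> real^'m \<Rightarrow> real^'m \<Rightarrow> real^'n" where
  "amb_hess G phi w u v = D (\<lambda>w'. D phi w' v) w u + christoffel G (phi w) (D phi w u) (D phi w v)"

text \<open>Shape operator A_xi (in the coordinates of the parametrization), defined by
g(A_xi X, Y) = g(h(X,Y), xi), i.e. A_xi = I^-1 B_xi with I the first fundamental
form matrix and B_xi the matrix of g(h(.,.),xi).\<close>
definition shape_op :: "(real^'n \<Rightarrow> real^'n^'n) \<Rightarrow> (real^'m \<Rightarrow> real^'n) \<Rightarrow> real^'m \<Rightarrow> real^'n \<Rightarrow> real^'m \<Rightarrow> real^'m" where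
  "shape_op G phi w \<xi> u =
     matrix_inv (\<chi> i j. gmet G (phi w) (D phi w (axis i 1)) (D phi w (axis j 1)))
     *v ((\<chi> i j. gmet G (phi w) (amb_hess G phi w (axis i 1) (axis j 1)) \<xi>) *v u)"

definition totally_umbilical :: "(real^'n \<Rightarrow> real^'n^'n) \<Rightarrow> (real^'m) set \<Rightarrow> (real^'m \<Rightarrow> real^'n) \<Rightarrow> bool" where
  "totally_umbilical G W phi \<longleftrightarrow>
     (\<forall>w\<in>W. \<forall>\<xi>. normal_vec G phi w \<xi> \<longrightarrow> (\<exists>\<mu>::real. \<forall>u. shape_op G phi w \<xi> u = \<mu> *\<^sub>R u))"

text \<open>Tangential component of V along the hypersurface vanishes: V is normal.\<close>
definition tangential_vanishes :: "(real^'n \<Rightarrow> real^'n^'n) \<Rightarrow> (real^'m) set \<Rightarrow> (real^'m \<Rightarrow> real^'n) \<Rightarrow> (real^'n \<Rightarrow> real^'n) \<Rightarrow> bool" where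
  "tangential_vanishes G W phi V \<longleftrightarrow> (\<forall>w\<in>W. normal_vec G phi w (V (phi w)))"

end

theory Submission
  imports Defs
begin

text \<open>Differentiating \<open>g(V, d\<phi>(v)) = 0\<close> along \<open>d\<phi>(u)\<close> and using metric compatibility gives
  \<open>g(h(X,Y), V) = - g(\<nabla>\<^sub>X V, Y)\<close> (Weingarten). For tangent \<open>X\<close> the anti-torqued equation
  reduces to \<open>\<nabla>\<^sub>X V = f X\<close>, so \<open>g(h(X,Y), V) = - f g(X,Y)\<close>. The normal space of a
  hypersurface is one-dimensional and contains \<open>V \<noteq> 0\<close>, so every normal \<open>\<xi>\<close> is \<open>c V\<close> and
  \<open>A\<^sub>\<xi> = - c f Id\<close>.\<close>

lemma smooth_on_imp_differentiable:
  assumes "smooth_on f S" "open S" "x \<in> S"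
  shows "f differentiable (at x)"
proof -
  have "Ck_on 1 f S" using assms(1) unfolding smooth_on_def by blast
  then show ?thesis using assms differentiable_on_eq_differentiable_at by auto
qed

lemma smooth_on_imp_D_differentiable:
  assumes "smooth_on f S" "open S" "x \<in> S"
  shows "(\<lambda>y. D f y v) differentiable (at x)"
proof -
  have "Ck_on 2 f S" using assms(1) unfolding smooth_on_def by blast
  then have "Ck_on 1 (\<lambda>y. D f y v) S" by (simp add: numeral_2_eq_2)
  then show ?thesis using assms differentiable_on_eq_differentiable_at by auto
qed

lemma has_derivative_D: "f differentiable (at x) \<Longrightarrow> (f has_derivative D f x) (at x)"
  unfolding D_def by (rule frechet_derivative_works[THEN iffD1])

lemma linear_D: "f differentiable (at x) \<Longrightarrow> linear (D f x)"
  using has_derivative_D has_derivative_linear by blast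

lemma has_derivative_zero_if_vanishing_on_open:
  assumes "(f has_derivative f') (at x)" "open S" "x \<in> S" "\<And>y. y \<in> S \<Longrightarrow> f y = 0"
  shows "f' = (\<lambda>h. 0)"
proof -
  have "(f has_derivative (\<lambda>h. 0)) (at x)"
    by (rule has_derivative_transform_within_open[OF has_derivative_const assms(2,3)])
      (use assms(4) in simp)
  then show ?thesis using has_derivative_unique assms(1) by blast
qed

lemma bounded_bilinear_matrix_vector_mult:
  "bounded_bilinear ((*v) :: real^'n^'m \<Rightarrow> real^'n \<Rightarrow> real^'m)"
  unfolding bilinear_conv_bounded_bilinear[symmetric] bilinear_def
  by (auto intro!: linearI simp:
      vec_eq_iff matrix_vector_mult_def sum_distrib_left algebra_simps sum.distrib)

lemma linear_functional_expansion:
  fixes F :: "real^'n \<Rightarrow> real"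
  assumes "linear F"
  shows "F z = (\<Sum>l\<in>UNIV. z$l * F (axis l 1))"
proof -
  have "F z = F (\<Sum>l\<in>UNIV. (z$l) *s axis l 1)" by (simp add: basis_expansion)
  also have "\<dots> = (\<Sum>l\<in>UNIV. z$l * F (axis l 1))"
    by (simp add: scalar_mult_eq_scaleR linear_sum[OF assms] linear_scale[OF assms] o_def)
  finally show ?thesis .
qed

lemma inner_matrix_of_bilinear:
  fixes b :: "real^'n \<Rightarrow> real^'n \<Rightarrow> real"
  assumes "bilinear b"
  shows "x \<bullet> ((\<chi> i j. b (axis i 1) (axis j 1)) *v y) = b x y"
proof -
  have row: "((\<chi> i j. b (axis i 1) (axis j 1)) *v y) $ i = b (axis i 1) y" for i
    using linear_functional_expansion[of "b (axis i 1)" y] assms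
    unfolding bilinear_def matrix_vector_mult_def by (simp add: mult.commute)
  show ?thesis
    using linear_functional_expansion[of "\<lambda>x. b x y" x] assms
    unfolding bilinear_def inner_vec_def row by simp
qed

lemma symmetric_matrix_inner_commute:
  assumes "transpose M = (M::real^'n^'n)"
  shows "u \<bullet> (M *v v) = v \<bullet> (M *v u)"
proof -
  have "u \<bullet> (M *v v) = (transpose M *v u) \<bullet> v" by (simp add: dot_lmul_matrix)
  then show ?thesis using assms by (simp add: inner_commute)
qed

lemma invertible_if_positive_definite:
  fixes A :: "real^'n^'n"
  assumes "\<And>x. x \<noteq> 0 \<Longrightarrow> x \<bullet> (A *v x) > 0"
  shows "invertible A"
  unfolding invertible_left_inverse matrix_left_invertible_ker
  using assms by (metis inner_zero_right less_irrefl)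

lemma matrix_inv_right: "invertible A \<Longrightarrow> A ** matrix_inv A = mat 1"
  and matrix_inv_left: "invertible A \<Longrightarrow> matrix_inv A ** A = mat 1"
  unfolding invertible_def matrix_inv_def by (metis (mono_tags, lifting) someI_ex)+

lemma D_symmetric_matrix_field:
  fixes G :: "real^'n \<Rightarrow> real^'n^'n"
  assumes "G differentiable (at p)" "open U" "p \<in> U" "\<And>q. q \<in> U \<Longrightarrow> transpose (G q) = G q"
  shows "transpose (D G p x) = D G p x"
proof -
  have "bounded_linear (transpose :: real^'n^'n \<Rightarrow> real^'n^'n)"
    by (auto intro!: linearI simp: linear_conv_bounded_linear[symmetric] vec_eq_iff transpose_def)
  from bounded_linear.has_derivative[OF this has_derivative_D[OF assms(1)]]
  have "((\<lambda>q. transpose (G q)) has_derivative (\<lambda>h. transpose (D G p h))) (at p)" .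
  then have "(G has_derivative (\<lambda>h. transpose (D G p h))) (at p)"
    by (rule has_derivative_transform_within_open[OF _ assms(2,3)]) (use assms(4) in simp)
  then show ?thesis using has_derivative_unique has_derivative_D[OF assms(1)] by metis
qed

lemma gmet_commute: "riem_metric G U \<Longrightarrow> p \<in> U \<Longrightarrow> gmet G p a b = gmet G p b a"
  unfolding riem_metric_def gmet_def using symmetric_matrix_inner_commute by blast

lemma gmet_scaleR_right: "gmet G p a (c *\<^sub>R b) = c * gmet G p a b"
  by (simp add: gmet_def matrix_vector_mult_scaleR)

lemma bilinear_gmet: "bilinear (gmet G p)"
  unfolding bilinear_def gmet_def
  by (auto intro!: linearI simp: inner_add_left inner_add_right
      matrix_vector_right_distrib matrix_vector_mult_scaleR)

lemma bilinear_gmet_linear_image: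
  assumes "linear L"
  shows "bilinear (\<lambda>x y. gmet G p (L x) (L y))"
  using bilinear_gmet[of G p] linear_compose[OF assms]
  unfolding bilinear_def o_def by blast

lemma gmet_christoffel:
  fixes G :: "real^'n \<Rightarrow> real^'n^'n"
  assumes "riem_metric G U" "p \<in> U"
  shows "gmet G p (christoffel G p x y) z
    = (y \<bullet> (D G p x *v z) + x \<bullet> (D G p y *v z) - x \<bullet> (D G p z *v y)) / 2"
proof -
  have "open U" "smooth_on G U" and sym: "transpose (G p) = G p"
    and pd: "\<And>x. x \<noteq> 0 \<Longrightarrow> x \<bullet> (G p *v x) > 0"
    using assms unfolding riem_metric_def by auto
  then have lin: "linear (D G p)"
    using linear_D smooth_on_imp_differentiable assms(2) by blast
  have inv: "G p ** matrix_inv (G p) = mat 1"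
    using matrix_inv_right invertible_if_positive_definite pd by blast
  have cancel: "(matrix_inv (G p) *v a) \<bullet> (G p *v z) = a \<bullet> z" for a
    using symmetric_matrix_inner_commute[OF sym, of "matrix_inv (G p) *v a" z]
    by (simp add: matrix_vector_mul_assoc inv inner_commute)
  have l1: "linear (\<lambda>e. y \<bullet> (M *v e))" for y and M :: "real^'n^'n"
    by (intro linearI)
      (simp_all add: matrix_vector_right_distrib inner_add_right matrix_vector_mult_scaleR)
  have l2: "linear (\<lambda>e. x \<bullet> (D G p e *v y))"
    using lin by (intro linearI) (simp_all add: linear_add linear_scale
        matrix_vector_mult_add_rdistrib inner_add_right scaleR_matrix_vector_assoc[symmetric])
  have coord: "(\<chi> l. a l) \<bullet> z = (\<Sum>l\<in>UNIV. z$l * a l)" for a :: "'n \<Rightarrow> real"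
    by (simp add: inner_vec_def mult.commute)
  show ?thesis
    unfolding christoffel_def gmet_def inner_scaleR_left cancel coord
    by (simp add: algebra_simps sum.distrib sum_subtractf
        linear_functional_expansion[OF l1, symmetric] linear_functional_expansion[OF l2, symmetric])
qed

lemma christoffel_metric_compatible:
  fixes G :: "real^'n \<Rightarrow> real^'n^'n"
  assumes "riem_metric G U" "p \<in> U"
  shows "gmet G p (christoffel G p x y) z + gmet G p (christoffel G p x z) y
    = y \<bullet> (D G p x *v z)"
proof -
  have "open U" "smooth_on G U" "\<And>q. q \<in> U \<Longrightarrow> transpose (G q) = G q"
    using assms(1) unfolding riem_metric_def by auto
  then have "transpose (D G p x) = D G p x"
    using D_symmetric_matrix_field smooth_on_imp_differentiable assms(2) by metis
  then have "z \<bullet> (D G p x *v y) = y \<bullet> (D G p x *v z)"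
    by (rule symmetric_matrix_inner_commute)
  then show ?thesis unfolding gmet_christoffel[OF assms] by (simp add: field_simps)
qed

lemma weingarten_normal_field:
  fixes G :: "real^'n \<Rightarrow> real^'n^'n" and phi :: "real^'m \<Rightarrow> real^'n"
  assumes G: "riem_metric G U" and W: "open W" "smooth_on phi W" "phi ` W \<subseteq> U"
    and N: "smooth_on N U" "\<forall>w'\<in>W. normal_vec G phi w' (N (phi w'))" and w: "w \<in> W"
  shows "gmet G (phi w) (amb_hess G phi w u v) (N (phi w))
    = - gmet G (phi w) (levi_civita G (phi w) (D phi w u) N) (D phi w v)"
proof -
  define p X Y D2 where "p = phi w" and "X = D phi w u" and "Y = D phi w v"
    and "D2 = D (\<lambda>w'. D phi w' v) w"
  have p: "p \<in> U" using W(3) w p_def by blast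
  have "open U" "smooth_on G U" using G unfolding riem_metric_def by auto
  then have dG: "(G has_derivative D G p) (at p)" and dN: "(N has_derivative D N p) (at p)"
    using has_derivative_D smooth_on_imp_differentiable N(1) p by blast+
  have dphi: "(phi has_derivative D phi w) (at w)"
    and dY: "((\<lambda>w'. D phi w' v) has_derivative D2) (at w)"
    using has_derivative_D smooth_on_imp_differentiable smooth_on_imp_D_differentiable W w D2_def
    by blast+
  have "((\<lambda>w'. N (phi w') \<bullet> (G (phi w') *v D phi w' v)) has_derivative
      (\<lambda>h. N p \<bullet> (G p *v D2 h + D G p (D phi w h) *v Y) + D N p (D phi w h) \<bullet> (G p *v Y))) (at w)"
    using has_derivative_inner[OF has_derivative_compose[OF dphi dN[unfolded p_def]]
        bounded_bilinear.FDERIV[OF bounded_bilinear_matrix_vector_mult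
          has_derivative_compose[OF dphi dG[unfolded p_def]] dY]]
    unfolding p_def Y_def by simp
  moreover have "N (phi w') \<bullet> (G (phi w') *v D phi w' v) = 0" if "w' \<in> W" for w'
    using N(2) that unfolding normal_vec_def gmet_def by blast
  ultimately have "(\<lambda>h. N p \<bullet> (G p *v D2 h + D G p (D phi w h) *v Y)
      + D N p (D phi w h) \<bullet> (G p *v Y)) = (\<lambda>h. 0)"
    using has_derivative_zero_if_vanishing_on_open W(1) w by blast
  from fun_cong[OF this, of u]
  have "gmet G p (D2 u) (N p) + N p \<bullet> (D G p X *v Y) + gmet G p (D N p X) Y = 0"
    using gmet_commute[OF G p] unfolding gmet_def X_def by (simp add: inner_add_right)
  moreover have "gmet G p (christoffel G p X (N p)) Y + gmet G p (christoffel G p X Y) (N p)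
      = N p \<bullet> (D G p X *v Y)"
    by (rule christoffel_metric_compatible[OF G p])
  ultimately show ?thesis
    unfolding amb_hess_def levi_civita_def p_def[symmetric] X_def[symmetric] Y_def[symmetric]
      D2_def[symmetric]
    by (simp add: gmet_def inner_add_left algebra_simps)
qed

lemma normal_vec_collinear:
  fixes G :: "real^'n \<Rightarrow> real^'n^'n" and phi :: "real^'m \<Rightarrow> real^'n"
  assumes G: "riem_metric G U" and phi: "hypersurface_param U W phi" and w: "w \<in> W"
    and N: "normal_vec G phi w N" "N \<noteq> 0" and \<xi>: "normal_vec G phi w \<xi>"
  obtains c where "\<xi> = c *\<^sub>R N"
proof -
  define p where "p = phi w"
  have card: "CARD('n) = CARD('m) + 1" and p: "p \<in> U" and injD: "inj (D phi w)"
    and "open W" "smooth_on phi W"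
    using phi w unfolding hypersurface_param_def p_def by auto
  then have linD: "linear (D phi w)" using linear_D smooth_on_imp_differentiable w by blast
  have "invertible (G p)"
    using G p invertible_if_positive_definite unfolding riem_metric_def by blast
  then have "inj ((*v) (G p))"
    using invertible_left_inverse matrix_left_invertible_injective by blast
  define L where "L = (\<lambda>u. G p *v D phi w u)"
  have linL: "linear L" and injL: "inj L"
    using linear_compose[OF linD matrix_vector_mul_linear[of "G p"]] inj_compose[OF _ injD]
      \<open>inj ((*v) (G p))\<close> unfolding L_def o_def by auto
  define C where "C = {y. \<forall>x\<in>range L. orthogonal x y}"
  have "dim C + dim (range L) = dim (UNIV :: (real^'n) set)"
    using dim_subspace_orthogonal_to_vectors[OF linear_subspace_image[OF linL subspace_UNIV]
        subspace_UNIV]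
    unfolding C_def by simp
  moreover have "dim (range L) = dim (UNIV :: (real^'m) set)"
    using dim_image_eq[OF linL] injL by (metis inj_on_subset subset_UNIV)
  ultimately have "dim C = 1" using card by simp
  have normal_in_C: "y \<in> C" if "normal_vec G phi w y" for y
    using that gmet_commute[OF G p] unfolding C_def L_def orthogonal_def normal_vec_def
    by (auto simp: gmet_def p_def inner_commute)
  have "span {N} = span C"
    by (rule dim_eq_span) (use normal_in_C N \<open>dim C = 1\<close> in auto)
  then have "\<xi> \<in> span {N}" using normal_in_C[OF \<xi>] span_base by metis
  then show ?thesis using that span_singleton by blast
qed

lemma first_fundamental_form_invertible:
  fixes G :: "real^'n \<Rightarrow> real^'n^'n" and phi :: "real^'m \<Rightarrow> real^'n"
  assumes "riem_metric G U" "phi w \<in> U" "linear (D phi w)" "inj (D phi w)"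
  shows "invertible (\<chi> i j. gmet G (phi w) (D phi w (axis i 1)) (D phi w (axis j 1)))"
proof (rule invertible_if_positive_definite)
  fix x :: "real^'m" assume "x \<noteq> 0"
  then have "D phi w x \<noteq> 0" using assms(3,4) by (simp add: linear_injective_0) blast
  then have "gmet G (phi w) (D phi w x) (D phi w x) > 0"
    using assms(1,2) unfolding riem_metric_def gmet_def by blast
  then show "x \<bullet> ((\<chi> i j. gmet G (phi w) (D phi w (axis i 1)) (D phi w (axis j 1))) *v x) > 0"
    using inner_matrix_of_bilinear[OF bilinear_gmet_linear_image[OF assms(3)]] by simp
qed

lemma shape_op_eq_scaleR:
  assumes "invertible (\<chi> i j. gmet G (phi w) (D phi w (axis i 1)) (D phi w (axis j 1)))"
    and "\<And>u v. gmet G (phi w) (amb_hess G phi w u v) \<xi>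
      = k * gmet G (phi w) (D phi w u) (D phi w v)"
  shows "shape_op G phi w \<xi> u = k *\<^sub>R u"
proof -
  have "(\<chi> i j. gmet G (phi w) (amb_hess G phi w (axis i 1) (axis j 1)) \<xi>)
      = k *\<^sub>R (\<chi> i j. gmet G (phi w) (D phi w (axis i 1)) (D phi w (axis j 1)))"
    using assms(2) by (simp add: vec_eq_iff)
  then show ?thesis
    unfolding shape_op_def
    by (simp add: scaleR_matrix_vector_assoc[symmetric] matrix_vector_mult_scaleR
        matrix_vector_mul_assoc matrix_inv_left[OF assms(1)])
qed

lemma anti_torqued_normal_umbilical_direction:
  fixes G :: "real^'n \<Rightarrow> real^'n^'n" and phi :: "real^'m \<Rightarrow> real^'n"
  assumes G: "riem_metric G U" and V: "anti_torqued G U V"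
    and W: "open W" "smooth_on phi W" "phi ` W \<subseteq> U"
    and V_normal: "tangential_vanishes G W phi V" and w: "w \<in> W"
  obtains k where "\<And>u v. gmet G (phi w) (amb_hess G phi w u v) (V (phi w))
    = k * gmet G (phi w) (D phi w u) (D phi w v)"
proof -
  obtain f where "smooth_on V U"
    and torqued: "\<forall>p\<in>U. \<forall>X. levi_civita G p X V = f p *\<^sub>R (X - gmet G p X (V p) *\<^sub>R V p)"
    using V unfolding anti_torqued_def by blast
  have p: "phi w \<in> U" using W(3) w by blast
  have "levi_civita G (phi w) (D phi w u) V = f (phi w) *\<^sub>R D phi w u" for u
    using torqued p V_normal w gmet_commute[OF G p]
    unfolding tangential_vanishes_def normal_vec_def by simp
  then show ?thesis
    using that[of "- f (phi w)"] V_normal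
      weingarten_normal_field[OF G W \<open>smooth_on V U\<close> _ w]
    unfolding tangential_vanishes_def by (simp add: gmet_def)
qed

theorem corollary4p2:
  fixes G :: "real^'n \<Rightarrow> real^'n^'n" and U :: "(real^'n) set"
    and V :: "real^'n \<Rightarrow> real^'n"
    and W :: "(real^'m) set" and phi :: "real^'m \<Rightarrow> real^'n"
  assumes "riem_metric G U"
    and "anti_torqued G U V"
    and "hypersurface_param U W phi"
    and "tangential_vanishes G W phi V"
  shows "totally_umbilical G W phi"
  unfolding totally_umbilical_def
proof (intro ballI allI impI)
  fix w \<xi> assume w: "w \<in> W" and \<xi>: "normal_vec G phi w \<xi>"
  have W: "open W" "smooth_on phi W" "phi ` W \<subseteq> U" "inj (D phi w)"
    using assms(3) w unfolding hypersurface_param_def by auto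
  then have "linear (D phi w)" using linear_D smooth_on_imp_differentiable w by blast
  obtain k where k: "\<And>u v. gmet G (phi w) (amb_hess G phi w u v) (V (phi w))
      = k * gmet G (phi w) (D phi w u) (D phi w v)"
    using anti_torqued_normal_umbilical_direction[OF assms(1,2) W(1-3) assms(4) w] by blast
  have "V (phi w) \<noteq> 0" using assms(2) W(3) w unfolding anti_torqued_def by blast
  then obtain c where "\<xi> = c *\<^sub>R V (phi w)"
    using normal_vec_collinear[OF assms(1,3) w _ _ \<xi>] assms(4) w
    unfolding tangential_vanishes_def by blast
  then have "gmet G (phi w) (amb_hess G phi w u v) \<xi>
      = (c * k) * gmet G (phi w) (D phi w u) (D phi w v)" for u v
    by (simp add: gmet_scaleR_right k)
  moreover have "invertible (\<chi> i j. gmet G (phi w) (D phi w (axis i 1)) (D phi w (axis j 1)))"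
    using first_fundamental_form_invertible[OF assms(1)] W w \<open>linear (D phi w)\<close> by blast
  ultimately show "\<exists>\<mu>. \<forall>u. shape_op G phi w \<xi> u = \<mu> *\<^sub>R u"
    using shape_op_eq_scaleR by blast
qed

end
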